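(* Let $H$ be a connected hypergraph with fixed sink vertex $q$ and nonsink vertices $[n]$. A configuration $\vec{c}\in\mathbb{Z}_{\ge 0}^n$ is superstable for $H$ if and only if it is superstable for the digraph $D_{\mathcal C}(H)$ (with sink $q$) for some choice of vertex induced cycling ${\mathcal C}$ of $H$.
   Context: A hypergraph $H=(V,E)$ consists of a finite vertex set $V$ and a set $E$ of subsets of $V$ of size at least $2$, called hyperedges. $H$ is connected if for any two vertices $v_1,v_2$ there is a sequence of hyperedges $(e_1,\dots,e_m)$ with $v_1\in e_1$, $v_2\in e_m$ and $e_i\cap e_{i+1}\neq\emptyset$ for all $i<m$. One vertex $q$ is the sink; the others are identified with $[n]$. A configuration is a vector $\vec{c}\in\mathbb{Z}_{\ge 0}^n$ of chips on the nonsink vertices. Superstability for $H$. A firing choice at $v\in[n]$ is a choice, for each hyperedge $e\ni v$, of a vertex $w\in e$ with $w\ne v$; firing $v$ with this choice removes one chip from $v$ for each hyperedge $e\ni v$ and gives it to the vertex chosen for $e$ (chips sent to $q$ are discarded). A firing choice for a set $T\subseteq V\setminus q$ is a firing choice for each $v\in T$, and firing $T$ performs all these moves simultaneously. It is cancellative if for every hyperedge $e\subseteq T$ the map sending each $v\in e$ to the vertex chosen by $v$ for $e$ is a (fixed-point-free) permutation of $e$. A nonempty $T\subseteq V\setminus q$ is ready to fire (in $H$) if every cancellative firing choice for $T$ results in a configuration with all coordinates nonnegative. $\vec{c}$ is superstable for $H$ if no nonempty $T\subseteq V\setminus q$ is ready to fire. Cyclings. A cycling ${\mathcal C}$ of $H$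 is a choice of a cyclic ordering of the elements of each hyperedge. The digraph $D_{\mathcal C}(H)$ has vertex set $V$ and, for each hyperedge $e$ and each $x\in e$ with immediate successor $y$ in the cyclic order on $e$, one directed edge $(x,y)$ from $x$ to $y$ (so edges are counted with multiplicity). A cycling is vertex induced if there is a total order on $V$ such that for each hyperedge $e=\{v_{i_1}<v_{i_2}<\dots<v_{i_p}\}$ the cyclic order on $e$ is $(v_{i_1}v_{i_2}\cdots v_{i_p})$. Superstability for a digraph $D$ with sink $q$ and nonsink vertices $[n]$. The reduced Laplacian $L_D$ is the $n\times n$ matrix with diagonal entries the outdegrees and off-diagonal entries $\ell_{i,j}=-|\{\text{edges from } i \text{ to } j\}|$. A nonempty $S\subseteq[n]$ is ready to fire for $\vec{c}$ if subtracting from $\vec{c}$ the columns of $L_D$ indexed by $S$ yields a vector with nonnegative entries. $\vec{c}$ is superstable for $D$ if no nonempty $S\subseteq[n]$ is ready to fire. *)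

theory Defs
  imports
    "HOL-Combinatorics.Orbits"
    "HOL-Combinatorics.Cycles"
    "Graph_Theory.Digraph"
begin

text \<open>
  The nonsink vertices, identified with $[n]$ in the text, are the elements of \<^term>\<open>V - {q}\<close>.
  Configurations are functions \<open>c :: 'a \<Rightarrow> nat\<close> of which only the values on \<^term>\<open>V - {q}\<close> are
  ever inspected; configurations after firing are integer valued, since they may have negative
  coordinates.
\<close>

section \<open>Hypergraphs\<close>

definition hypergraph :: "'a set \<Rightarrow> 'a set set \<Rightarrow> bool" where
  "hypergraph V E \<longleftrightarrow> finite V \<and> (\<forall>e\<in>E. e \<subseteq> V \<and> 2 \<le> card e)"

definition hypergraph_connected :: "'a set \<Rightarrow> 'a set set \<Rightarrow> bool" where
  "hypergraph_connected V E \<longleftrightarrow>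
     (\<forall>v\<^sub>1\<in>V. \<forall>v\<^sub>2\<in>V. v\<^sub>1 \<noteq> v\<^sub>2 \<longrightarrow>
        (\<exists>es. es \<noteq> [] \<and> set es \<subseteq> E \<and> v\<^sub>1 \<in> hd es \<and> v\<^sub>2 \<in> last es \<and>
              (\<forall>i. Suc i < length es \<longrightarrow> es ! i \<inter> es ! Suc i \<noteq> {})))"

section \<open>Superstability for a hypergraph\<close>

text \<open>\<open>\<phi> v e\<close> is the vertex that receives the chip sent by \<open>v\<close> along the hyperedge \<open>e\<close>.\<close>

definition firing_choice :: "'a set set \<Rightarrow> 'a set \<Rightarrow> ('a \<Rightarrow> 'a set \<Rightarrow> 'a) \<Rightarrow> bool" where
  "firing_choice E T \<phi> \<longleftrightarrow> (\<forall>v\<in>T. \<forall>e\<in>E. v \<in> e \<longrightarrow> \<phi> v e \<in> e \<and> \<phi> v e \<noteq> v)"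

text \<open>Being free of fixed points is already part of \<^const>\<open>firing_choice\<close>.\<close>

definition cancellative :: "'a set set \<Rightarrow> 'a set \<Rightarrow> ('a \<Rightarrow> 'a set \<Rightarrow> 'a) \<Rightarrow> bool" where
  "cancellative E T \<phi> \<longleftrightarrow> (\<forall>e\<in>E. e \<subseteq> T \<longrightarrow> bij_betw (\<lambda>v. \<phi> v e) e e)"

definition fire :: "'a set set \<Rightarrow> 'a set \<Rightarrow> ('a \<Rightarrow> 'a set \<Rightarrow> 'a) \<Rightarrow> ('a \<Rightarrow> nat) \<Rightarrow> 'a \<Rightarrow> int" where
  "fire E T \<phi> c i =
     int (c i) - (if i \<in> T then int (card {e \<in> E. i \<in> e}) else 0)
     + int (card {(v, e). v \<in> T \<and> e \<in> E \<and> v \<in> e \<and> \<phi> v e = i})"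

definition hyper_ready ::
  "'a set \<Rightarrow> 'a set set \<Rightarrow> 'a \<Rightarrow> ('a \<Rightarrow> nat) \<Rightarrow> 'a set \<Rightarrow> bool" where
  "hyper_ready V E q c T \<longleftrightarrow>
     (\<forall>\<phi>. firing_choice E T \<phi> \<and> cancellative E T \<phi> \<longrightarrow> (\<forall>i\<in>V - {q}. 0 \<le> fire E T \<phi> c i))"

definition hyper_superstable :: "'a set \<Rightarrow> 'a set set \<Rightarrow> 'a \<Rightarrow> ('a \<Rightarrow> nat) \<Rightarrow> bool" where
  "hyper_superstable V E q c \<longleftrightarrow>
     \<not> (\<exists>T. T \<noteq> {} \<and> T \<subseteq> V - {q} \<and> hyper_ready V E q c T)"

section \<open>Cyclings\<close>

text \<open>
  A cyclic ordering of \<open>e\<close> is given by its successor function \<open>C e\<close>: a permutation of \<open>e\<close>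
  consisting of a single cycle.
\<close>

definition cycling :: "'a set set \<Rightarrow> ('a set \<Rightarrow> 'a \<Rightarrow> 'a) \<Rightarrow> bool" where
  "cycling E C \<longleftrightarrow> (\<forall>e\<in>E. C e permutes e \<and> cyclic_on (C e) e)"

text \<open>
  \<open>r\<close> is reflexive and consists of the pairs $(x, y)$ with $x \le y$;
  \<open>vs\<close> is the increasing enumeration of \<open>e\<close>.
\<close>

definition vertex_induced :: "'a set \<Rightarrow> 'a set set \<Rightarrow> ('a set \<Rightarrow> 'a \<Rightarrow> 'a) \<Rightarrow> bool" where
  "vertex_induced V E C \<longleftrightarrow>
     (\<exists>r. linear_order_on V r \<and>
        (\<forall>e\<in>E. \<exists>vs. distinct vs \<and> set vs = e \<and> sorted_wrt (\<lambda>x y. (x, y) \<in> r) vs \<and>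
                    C e = cycle_of_list vs))"

text \<open>The arc \<open>(e, x)\<close> leads from \<open>x\<close> to its successor in \<open>e\<close>, so parallel arcs stay distinct.\<close>

definition cycling_digraph ::
  "'a set \<Rightarrow> 'a set set \<Rightarrow> ('a set \<Rightarrow> 'a \<Rightarrow> 'a) \<Rightarrow> ('a, 'a set \<times> 'a) pre_digraph" where
  "cycling_digraph V E C =
     \<lparr>verts = V, arcs = {(e, x). e \<in> E \<and> x \<in> e}, tail = (\<lambda>(e, x). x), head = (\<lambda>(e, x). C e x)\<rparr>"

section \<open>Superstability for a digraph\<close>

text \<open>Only the entries with row and column index in \<^term>\<open>verts D - {q}\<close> are meaningful.\<close>

definition reduced_laplacian :: "('a, 'b) pre_digraph \<Rightarrow> 'a \<Rightarrow> 'a \<Rightarrow> int" where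
  "reduced_laplacian D i j =
     (if i = j then int (out_degree D i)
      else - int (card {a \<in> arcs D. tail D a = i \<and> head D a = j}))"

definition digraph_ready :: "('a, 'b) pre_digraph \<Rightarrow> 'a \<Rightarrow> ('a \<Rightarrow> nat) \<Rightarrow> 'a set \<Rightarrow> bool" where
  "digraph_ready D q c S \<longleftrightarrow>
     (\<forall>i\<in>verts D - {q}. 0 \<le> int (c i) - (\<Sum>j\<in>S. reduced_laplacian D i j))"

definition digraph_superstable :: "('a, 'b) pre_digraph \<Rightarrow> 'a \<Rightarrow> ('a \<Rightarrow> nat) \<Rightarrow> bool" where
  "digraph_superstable D q c \<longleftrightarrow>
     \<not> (\<exists>S. S \<noteq> {} \<and> S \<subseteq> verts D - {q} \<and> digraph_ready D q c S)"

end

theory Submission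
  imports Defs
begin

text \<open>
  Both kinds of readiness reduce to a condition on the vertices of the fired set alone. A set \<open>T\<close> is
  ready to fire in the hypergraph iff every \<open>i \<in> T\<close> holds a chip for each hyperedge at \<open>i\<close> that is
  not contained in \<open>T\<close> (\<open>hyper_ready_iff\<close>): a cancellative choice gives back to \<open>i\<close> what it spends
  on the hyperedges inside \<open>T\<close>, and in the worst case all chips sent along the other hyperedges
  leave \<open>T\<close>. A set is ready to fire in the digraph of a cycling iff every \<open>i \<in> T\<close> holds a chip for
  each hyperedge in which the successor of \<open>i\<close> lies outside \<open>T\<close> (\<open>digraph_ready_cycling_iff\<close>).

  The second condition is weaker, for every cycling, because a successor outside \<open>T\<close> is a witness
  that the hyperedge is not contained in \<open>T\<close>. Hence superstability for the digraph of any
  cycling gives superstability for the hypergraph.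

  Conversely, let \<open>c\<close> be superstable for the hypergraph. Then Dhar's burning procedure, started
  at \<open>q\<close>, burns every vertex: as long as the set \<open>T\<close> of unburnt vertices is nonempty, it is not
  ready, so some \<open>i \<in> T\<close> holds fewer chips than there are hyperedges at \<open>i\<close> that meet the burnt
  set, and \<open>i\<close> burns next. Order the vertices by decreasing burning time and take the cycling
  induced by this order (\<open>burning_order\<close>, \<open>linear_order_from_list\<close>). Given a nonempty
  \<open>S \<subseteq> V - {q}\<close>, consider its vertex \<open>x\<close> that burns first. In each hyperedge at \<open>x\<close> that meets the
  vertices burnt before \<open>x\<close>, the successor of \<open>x\<close> is one of these, hence lies outside \<open>S\<close>. So \<open>x\<close>
  lacks chips for these hyperedges, and \<open>S\<close> is not ready in the digraph.
\<close>

section \<open>Cycles given by lists\<close>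

lemma cycle_of_list_nth:
  assumes "distinct vs" and "i < length vs"
  shows "cycle_of_list vs (vs ! i) = vs ! (Suc i mod length vs)"
proof -
  have "map (cycle_of_list vs) vs ! i = rotate 1 vs ! i"
    using cyclic_rotation[OF assms(1), of 1] by simp
  then show ?thesis
    using assms(2) nth_rotate[of i vs 1] by simp
qed

lemma cycle_of_list_successor:
  assumes "distinct (xs @ x # y # zs)"
  shows "cycle_of_list (xs @ x # y # zs) x = y"
  using cycle_of_list_nth[OF assms, of "length xs"] by (simp add: nth_append)

lemma cyclic_on_cycle_of_list:
  assumes "distinct vs" and "vs \<noteq> []"
  shows "cyclic_on (cycle_of_list vs) (set vs)"
proof -
  let ?f = "cycle_of_list vs" and ?n = "length vs"
  have pow: "(?f ^^ k) (vs ! 0) = vs ! (k mod ?n)" for k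
  proof -
    have "map (?f ^^ k) vs ! 0 = rotate k vs ! 0"
      using cyclic_rotation[OF assms(1), of k] by simp
    then show ?thesis
      using assms(2) nth_rotate[of 0 vs k] by simp
  qed
  have "set vs = orbit ?f (vs ! 0)"
  proof (intro equalityI subsetI)
    fix y assume "y \<in> set vs"
    then obtain i where i: "i < ?n" "y = vs ! i"
      by (auto simp: in_set_conv_nth)
    \<comment> \<open>An orbit consists of positive iterates; going around once more makes the exponent positive.\<close>
    then have "(?f ^^ (i + ?n)) (vs ! 0) = y" and "0 < i + ?n"
      by (auto simp: pow)
    then show "y \<in> orbit ?f (vs ! 0)"
      by (auto simp: orbit_altdef)
  next
    fix y assume "y \<in> orbit ?f (vs ! 0)"
    then show "y \<in> set vs"
      using assms(2) by (auto simp: orbit_altdef pow)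
  qed
  then show ?thesis
    using assms(2) by (auto simp: cyclic_on_def)
qed

section \<open>Readiness to fire as a local condition\<close>

lemma hypergraph_finite_edges: "hypergraph V E \<Longrightarrow> finite E"
  by (rule finite_subset[of E "Pow V"]) (auto simp: hypergraph_def)

text \<open>
  The choice that is worst for all vertices of \<open>T\<close> at once: on each
  hyperedge inside \<open>T\<close> it follows a full cycle, which is a permutation without fixed points as
  cancellativity demands, and along the others it sends the chips out of \<open>T\<close>.
\<close>

lemma worst_firing_choice:
  assumes "hypergraph V E"
  obtains \<phi> where "firing_choice E T \<phi>" and "cancellative E T \<phi>"
    and "\<And>v e. \<lbrakk>e \<in> E; \<not> e \<subseteq> T\<rbrakk> \<Longrightarrow> \<phi> v e \<notin> T"
proof -
  have "\<exists>f. bij_betw f e e \<and> (\<forall>v\<in>e. f v \<noteq> v)" if "e \<in> E" for e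
  proof -
    have card: "2 \<le> card e" and fin: "finite e"
      using assms that finite_subset by (auto simp: hypergraph_def)
    obtain vs where vs: "distinct vs" "set vs = e"
      using finite_distinct_list[OF fin] by blast
    have "cyclic_on (cycle_of_list vs) e"
      using cyclic_on_cycle_of_list[of vs] vs card by force
    then have "\<forall>v\<in>e. cycle_of_list vs v \<noteq> v"
      using card by (metis eq_on_cyclic_on_iff1 Suc_1 Suc_n_not_le_n)
    moreover have "bij_betw (cycle_of_list vs) e e"
      using cycle_permutes[of vs] vs(2) by (simp add: permutes_imp_bij)
    ultimately show ?thesis by blast
  qed
  then obtain f where f: "\<And>e. e \<in> E \<Longrightarrow> bij_betw (f e) e e \<and> (\<forall>v\<in>e. f e v \<noteq> v)"
    by metis
  define \<phi> where "\<phi> v e = (if e \<subseteq> T then f e v else SOME w. w \<in> e - T)" for v e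
  have out: "\<phi> v e \<in> e - T" if "\<not> e \<subseteq> T" for v e
  proof -
    have "\<exists>w. w \<in> e - T" using that by blast
    then have "(SOME w. w \<in> e - T) \<in> e - T" by (rule someI_ex)
    then show ?thesis using that by (simp add: \<phi>_def)
  qed
  have ins: "\<phi> v e = f e v" if "e \<subseteq> T" for v e
    using that by (simp add: \<phi>_def)
  show ?thesis
  proof
    have "\<phi> v e \<in> e \<and> \<phi> v e \<noteq> v" if "v \<in> T" "e \<in> E" "v \<in> e" for v e
    proof (cases "e \<subseteq> T")
      case True
      then show ?thesis using f[OF \<open>e \<in> E\<close>] that ins by (auto dest: bij_betw_apply)
    next
      case False
      then show ?thesis using out[of e v] that by auto
    qed
    then show "firing_choice E T \<phi>" by (auto simp: firing_choice_def)
    show "cancellative E T \<phi>"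
      using f by (simp add: cancellative_def ins)
    show "\<phi> v e \<notin> T" if "e \<in> E" "\<not> e \<subseteq> T" for v e
      using out[OF that(2)] by blast
  qed
qed

lemma hyper_ready_iff:
  assumes "hypergraph V E" and "T \<subseteq> V - {q}"
  shows "hyper_ready V E q c T \<longleftrightarrow> (\<forall>i\<in>T. card {e \<in> E. i \<in> e \<and> \<not> e \<subseteq> T} \<le> c i)"
proof -
  note finE = hypergraph_finite_edges[OF assms(1)]
  have finT: "finite T"
    using assms finite_subset by (auto simp: hypergraph_def)
  have split: "card {e \<in> E. i \<in> e} = card {e \<in> E. i \<in> e \<and> \<not> e \<subseteq> T} + card {e \<in> E. i \<in> e \<and> e \<subseteq> T}"
    for i
    using finE by (subst card_Un_disjoint[symmetric]) (auto intro: arg_cong[where f = card])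
  let ?R = "\<lambda>\<phi> i. {(v, e). v \<in> T \<and> e \<in> E \<and> v \<in> e \<and> \<phi> v e = i}"
  have finR: "finite (?R \<phi> i)" for \<phi> i
    by (rule finite_subset[of _ "T \<times> E"]) (auto simp: finT finE)
  \<comment> \<open>The choice permutes a hyperedge inside \<open>T\<close>, so each of its vertices receives one chip.\<close>
  have received: "bij_betw snd {(v, e). e \<subseteq> T \<and> e \<in> E \<and> v \<in> e \<and> \<phi> v e = i} {e \<in> E. i \<in> e \<and> e \<subseteq> T}"
    if "cancellative E T \<phi>" for \<phi> i
    unfolding bij_betw_def
  proof
    have bij: "bij_betw (\<lambda>v. \<phi> v e) e e" if "e \<in> E" "e \<subseteq> T" for e
      using that \<open>cancellative E T \<phi>\<close> by (simp add: cancellative_def)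
    show "inj_on snd {(v, e). e \<subseteq> T \<and> e \<in> E \<and> v \<in> e \<and> \<phi> v e = i}"
      using bij by (auto simp: inj_on_def bij_betw_def)
    show "snd ` {(v, e). e \<subseteq> T \<and> e \<in> E \<and> v \<in> e \<and> \<phi> v e = i} = {e \<in> E. i \<in> e \<and> e \<subseteq> T}"
    proof (intro equalityI subsetI)
      fix e assume e: "e \<in> {e \<in> E. i \<in> e \<and> e \<subseteq> T}"
      then have "i \<in> (\<lambda>v. \<phi> v e) ` e"
        using bij[of e] by (simp add: bij_betw_def)
      then obtain v where "v \<in> e" "\<phi> v e = i" by blast
      with e have "(v, e) \<in> {(v, e). e \<subseteq> T \<and> e \<in> E \<and> v \<in> e \<and> \<phi> v e = i}" by auto
      then show "e \<in> snd ` {(v, e). e \<subseteq> T \<and> e \<in> E \<and> v \<in> e \<and> \<phi> v e = i}"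
        by (rule image_eqI[rotated]) simp
    next
      fix e assume "e \<in> snd ` {(v, e). e \<subseteq> T \<and> e \<in> E \<and> v \<in> e \<and> \<phi> v e = i}"
      then obtain v where "e \<in> E" "e \<subseteq> T" "v \<in> e" "\<phi> v e = i" by auto
      then show "e \<in> {e \<in> E. i \<in> e \<and> e \<subseteq> T}"
        using bij_betw_apply[OF bij, of e v] by simp
    qed
  qed
  show ?thesis
  proof (intro iffI ballI)
    fix i assume ready: "hyper_ready V E q c T" and "i \<in> T"
    obtain \<phi> where \<phi>: "firing_choice E T \<phi>" "cancellative E T \<phi>"
      and out: "\<And>v e. \<lbrakk>e \<in> E; \<not> e \<subseteq> T\<rbrakk> \<Longrightarrow> \<phi> v e \<notin> T"
      using worst_firing_choice[OF assms(1)] by blast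
    have "?R \<phi> i = {(v, e). e \<subseteq> T \<and> e \<in> E \<and> v \<in> e \<and> \<phi> v e = i}"
      using out \<open>i \<in> T\<close> by blast
    then have "card (?R \<phi> i) = card {e \<in> E. i \<in> e \<and> e \<subseteq> T}"
      using bij_betw_same_card[OF received[OF \<phi>(2), of i]] by simp
    moreover have "0 \<le> fire E T \<phi> c i"
      using ready \<phi> \<open>i \<in> T\<close> assms(2) by (auto simp: hyper_ready_def)
    ultimately show "card {e \<in> E. i \<in> e \<and> \<not> e \<subseteq> T} \<le> c i"
      using \<open>i \<in> T\<close> split[of i] by (simp add: fire_def)
  next
    assume le: "\<forall>i\<in>T. card {e \<in> E. i \<in> e \<and> \<not> e \<subseteq> T} \<le> c i"
    have "0 \<le> fire E T \<phi> c i" if "cancellative E T \<phi>" for \<phi> i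
    proof (cases "i \<in> T")
      case True
      have "card {(v, e). e \<subseteq> T \<and> e \<in> E \<and> v \<in> e \<and> \<phi> v e = i} \<le> card (?R \<phi> i)"
        by (intro card_mono finR) auto
      then have "card {e \<in> E. i \<in> e \<and> e \<subseteq> T} \<le> card (?R \<phi> i)"
        using bij_betw_same_card[OF received[OF that, of i]] by simp
      moreover have "card {e \<in> E. i \<in> e \<and> \<not> e \<subseteq> T} \<le> c i"
        using le True by blast
      ultimately show ?thesis
        using split[of i] True by (simp add: fire_def)
    qed (simp add: fire_def)
    then show "hyper_ready V E q c T"
      by (simp add: hyper_ready_def)
  qed
qed

text \<open>
  Vertices outside \<open>S\<close> only gain chips. A vertex \<open>i \<in> S\<close> spends one chip per hyperedge, and the terms
  of the other \<open>j \<in> S\<close> refund the chips that it sends to \<open>j\<close>, as \<open>i\<close> is never its own successor.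
\<close>

lemma digraph_ready_cycling_iff:
  assumes "hypergraph V E" and "cycling E C" and "S \<subseteq> V - {q}"
  shows "digraph_ready (cycling_digraph V E C) q c S \<longleftrightarrow>
    (\<forall>i\<in>S. card {e \<in> E. i \<in> e \<and> C e i \<notin> S} \<le> c i)"
proof -
  let ?D = "cycling_digraph V E C"
  note finE = hypergraph_finite_edges[OF assms(1)]
  have finS: "finite S"
    using assms finite_subset by (auto simp: hypergraph_def)
  have no_loop: "C e i \<noteq> i" if "e \<in> E" "i \<in> e" for e i
  proof -
    have "cyclic_on (C e) e" "2 \<le> card e"
      using assms that by (auto simp: cycling_def hypergraph_def)
    then show ?thesis
      using that by (metis eq_on_cyclic_on_iff1 Suc_1 Suc_n_not_le_n)
  qed
  have arcs_at: "card {a \<in> arcs ?D. tail ?D a = i \<and> P (head ?D a)} = card {e \<in> E. i \<in> e \<and> P (C e i)}"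
    for i P
  proof -
    have "{a \<in> arcs ?D. tail ?D a = i \<and> P (head ?D a)} = (\<lambda>e. (e, i)) ` {e \<in> E. i \<in> e \<and> P (C e i)}"
      by (auto simp: cycling_digraph_def)
    then show ?thesis
      by (simp add: card_image inj_on_def)
  qed
  have outdeg: "out_degree ?D i = card {e \<in> E. i \<in> e}" for i
    using arcs_at[of i "\<lambda>_. True"] by (simp add: out_degree_def out_arcs_def)
  have lap: "reduced_laplacian ?D i j =
      (if i = j then int (card {e \<in> E. i \<in> e}) else - int (card {e \<in> E. i \<in> e \<and> C e i = j}))" for i j
    using arcs_at[of i "\<lambda>w. w = j"] by (simp add: reduced_laplacian_def outdeg)
  have inside: "(\<Sum>j\<in>S. reduced_laplacian ?D i j) = int (card {e \<in> E. i \<in> e \<and> C e i \<notin> S})"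
    if "i \<in> S" for i
  proof -
    have "(\<Sum>j\<in>S - {i}. card {e \<in> E. i \<in> e \<and> C e i = j}) =
        card (\<Union>j\<in>S - {i}. {e \<in> E. i \<in> e \<and> C e i = j})"
      using finS finE by (intro card_UN_disjoint[symmetric]) auto
    also have "(\<Union>j\<in>S - {i}. {e \<in> E. i \<in> e \<and> C e i = j}) = {e \<in> E. i \<in> e \<and> C e i \<in> S}"
      using no_loop by auto
    finally have others: "(\<Sum>j\<in>S - {i}. card {e \<in> E. i \<in> e \<and> C e i = j}) =
        card {e \<in> E. i \<in> e \<and> C e i \<in> S}" .
    have "(\<Sum>j\<in>S. reduced_laplacian ?D i j) =
        reduced_laplacian ?D i i + (\<Sum>j\<in>S - {i}. reduced_laplacian ?D i j)"
      using finS that by (simp add: sum.remove)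
    also have "(\<Sum>j\<in>S - {i}. reduced_laplacian ?D i j) =
        - int (\<Sum>j\<in>S - {i}. card {e \<in> E. i \<in> e \<and> C e i = j})"
      unfolding of_nat_sum sum_negf[symmetric] by (intro sum.cong) (auto simp: lap)
    finally have "(\<Sum>j\<in>S. reduced_laplacian ?D i j) =
        int (card {e \<in> E. i \<in> e}) - int (card {e \<in> E. i \<in> e \<and> C e i \<in> S})"
      by (simp add: others lap)
    moreover have "card {e \<in> E. i \<in> e} =
        card {e \<in> E. i \<in> e \<and> C e i \<notin> S} + card {e \<in> E. i \<in> e \<and> C e i \<in> S}"
      using finE by (subst card_Un_disjoint[symmetric]) (auto intro: arg_cong[where f = card])
    ultimately show ?thesis by simp
  qed
  have outside: "(\<Sum>j\<in>S. reduced_laplacian ?D i j) \<le> 0" if "i \<notin> S" for i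
    using that by (intro sum_nonpos) (auto simp: lap)
  have "0 \<le> int (c i) - (\<Sum>j\<in>S. reduced_laplacian ?D i j) \<longleftrightarrow>
      (i \<in> S \<longrightarrow> card {e \<in> E. i \<in> e \<and> C e i \<notin> S} \<le> c i)" for i
    using inside[of i] outside[of i] by (cases "i \<in> S") auto
  moreover have "verts ?D = V"
    by (simp add: cycling_digraph_def)
  ultimately show ?thesis
    using assms(3) by (auto simp: digraph_ready_def)
qed

section \<open>The burning order\<close>

text \<open>
  Dhar's burning procedure in the abstract: \<open>P x T\<close> says that \<open>x\<close> may burn when \<open>T\<close> is the set of
  vertices not yet burnt. The list is in reverse burning order, so that the set of vertices still
  unburnt when \<open>x\<close> burns is the prefix of the list that ends in \<open>x\<close>.
\<close>

lemma burning_order: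
  assumes "finite W" and "\<And>T. \<lbrakk>T \<noteq> {}; T \<subseteq> W\<rbrakk> \<Longrightarrow> \<exists>x\<in>T. P x T"
  shows "\<exists>us. distinct us \<and> set us = W \<and> (\<forall>xs x zs. us = xs @ x # zs \<longrightarrow> P x (insert x (set xs)))"
  using assms
proof (induction W rule: finite_psubset_induct)
  case (psubset W)
  show ?case
  proof (cases "W = {}")
    case True
    then show ?thesis by simp
  next
    case False
    then obtain w where w: "w \<in> W" "P w W"
      using psubset.prems[of W] by blast
    have "W - {w} \<subset> W"
      using w(1) by blast
    moreover have "\<exists>x\<in>T. P x T" if "T \<noteq> {}" "T \<subseteq> W - {w}" for T
      using psubset.prems[of T] that by blast
    ultimately obtain us where us: "distinct us" "set us = W - {w}"
      "\<And>xs x zs. us = xs @ x # zs \<Longrightarrow> P x (insert x (set xs))"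
      using psubset.IH[of "W - {w}"] by blast
    have "P x (insert x (set xs))" if eq: "us @ [w] = xs @ x # zs" for xs x zs
    proof (cases zs rule: rev_cases)
      case Nil
      then show ?thesis
        using eq us(2) w by (simp add: insert_absorb)
    next
      case (snoc zs' z)
      then show ?thesis
        using eq us(3)[of xs x zs'] by simp
    qed
    moreover have "distinct (us @ [w])" "set (us @ [w]) = W"
      using us(1,2) w(1) by auto
    ultimately show ?thesis by blast
  qed
qed

lemma linear_order_from_list:
  assumes "distinct us"
  shows "\<exists>r. linear_order_on (set us) r \<and> sorted_wrt (\<lambda>x y. (x, y) \<in> r) us"
proof -
  define r where "r = {(us ! i, us ! j) | i j. i \<le> j \<and> j < length us}"
  have mem: "(us ! i, us ! j) \<in> r \<longleftrightarrow> i \<le> j" if "i < length us" "j < length us" for i j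
    using that assms by (auto simp: r_def nth_eq_iff_index_eq)
  have sub: "r \<subseteq> set us \<times> set us"
    by (auto simp: r_def)
  have "refl_on (set us) r"
    by (auto simp: refl_on_def in_set_conv_nth mem)
  moreover have "trans r"
  proof (rule transI)
    fix x y z assume xy: "(x, y) \<in> r" and yz: "(y, z) \<in> r"
    then have "x \<in> set us" "y \<in> set us" "z \<in> set us"
      using sub by blast+
    then obtain i j k where "i < length us" "j < length us" "k < length us"
      "x = us ! i" "y = us ! j" "z = us ! k"
      by (metis in_set_conv_nth)
    then show "(x, z) \<in> r"
      using xy yz by (simp add: mem)
  qed
  moreover have "antisym r"
  proof (rule antisymI)
    fix x y assume xy: "(x, y) \<in> r" and yx: "(y, x) \<in> r"
    then have "x \<in> set us" "y \<in> set us"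
      using sub by blast+
    then obtain i j where "i < length us" "j < length us" "x = us ! i" "y = us ! j"
      by (metis in_set_conv_nth)
    then show "x = y"
      using xy yx by (simp add: mem)
  qed
  moreover have "total_on (set us) r"
    by (auto simp: total_on_def in_set_conv_nth mem)
  moreover have "sorted_wrt (\<lambda>x y. (x, y) \<in> r) us"
    by (auto simp: sorted_wrt_iff_nth_less mem)
  ultimately show ?thesis
    using sub by (auto simp: order_on_defs)
qed

section \<open>The equivalence\<close>

theorem theorem5p15:
  fixes V :: "'a set" and E :: "'a set set" and q :: 'a and c :: "'a \<Rightarrow> nat"
  assumes "hypergraph V E" and "hypergraph_connected V E" and "q \<in> V"
  shows "hyper_superstable V E q c \<longleftrightarrow>
    (\<exists>C. cycling E C \<and> vertex_induced V E C \<and> digraph_superstable (cycling_digraph V E C) q c)"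
proof
  assume "\<exists>C. cycling E C \<and> vertex_induced V E C \<and> digraph_superstable (cycling_digraph V E C) q c"
  then obtain C where C: "cycling E C" and stable: "digraph_superstable (cycling_digraph V E C) q c"
    by blast
  have "digraph_ready (cycling_digraph V E C) q c T"
    if T: "T \<subseteq> V - {q}" and ready: "hyper_ready V E q c T" for T
    unfolding digraph_ready_cycling_iff[OF assms(1) C T]
  proof
    fix i assume "i \<in> T"
    have "{e \<in> E. i \<in> e \<and> C e i \<notin> T} \<subseteq> {e \<in> E. i \<in> e \<and> \<not> e \<subseteq> T}"
      using C by (auto simp: cycling_def dest: permutes_in_image)
    then have "card {e \<in> E. i \<in> e \<and> C e i \<notin> T} \<le> card {e \<in> E. i \<in> e \<and> \<not> e \<subseteq> T}"
      using hypergraph_finite_edges[OF assms(1)] by (intro card_mono) auto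
    also have "\<dots> \<le> c i"
      using ready \<open>i \<in> T\<close> by (simp add: hyper_ready_iff[OF assms(1) T])
    finally show "card {e \<in> E. i \<in> e \<and> C e i \<notin> T} \<le> c i" .
  qed
  then show "hyper_superstable V E q c"
    using stable by (auto simp: hyper_superstable_def digraph_superstable_def cycling_digraph_def)
next
  assume stable: "hyper_superstable V E q c"
  have finE: "finite E" and finV: "finite V"
    using assms(1) hypergraph_finite_edges by (auto simp: hypergraph_def)
  let ?burns = "\<lambda>x T. c x < card {e \<in> E. x \<in> e \<and> \<not> e \<subseteq> T}"
  have "\<exists>x\<in>T. ?burns x T" if T: "T \<noteq> {}" "T \<subseteq> V - {q}" for T
  proof -
    have "\<not> hyper_ready V E q c T"
      using stable T unfolding hyper_superstable_def by blast
    then show ?thesis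
      unfolding hyper_ready_iff[OF assms(1) T(2)] by (simp add: not_le)
  qed
  then have "\<exists>us. distinct us \<and> set us = V - {q} \<and>
      (\<forall>xs x zs. us = xs @ x # zs \<longrightarrow> ?burns x (insert x (set xs)))"
    using finV by (intro burning_order) simp_all
  then obtain us where us: "distinct us" "set us = V - {q}"
    and burn: "\<And>xs x zs. us = xs @ x # zs \<Longrightarrow> ?burns x (insert x (set xs))"
    by blast
  \<comment> \<open>The sink burns first, so it is the largest vertex.\<close>
  define ws where "ws = us @ [q]"
  have ws: "distinct ws" "set ws = V"
    using us assms(3) by (auto simp: ws_def)
  define vs where "vs e = filter (\<lambda>x. x \<in> e) ws" for e
  define C where "C e = cycle_of_list (vs e)" for e
  have vs: "distinct (vs e)" "set (vs e) = e" if "e \<in> E" for e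
    using that ws assms(1) by (auto simp: vs_def hypergraph_def)
  have C: "cycling E C"
    unfolding cycling_def
  proof
    fix e assume "e \<in> E"
    then have "e \<noteq> {}"
      using assms(1) by (auto simp: hypergraph_def)
    then have "vs e \<noteq> []"
      using vs(2)[OF \<open>e \<in> E\<close>] by (metis set_empty)
    then show "C e permutes e \<and> cyclic_on (C e) e"
      using vs[OF \<open>e \<in> E\<close>] cycle_permutes[of "vs e"] cyclic_on_cycle_of_list[of "vs e"]
      by (simp add: C_def)
  qed
  obtain r where r: "linear_order_on V r" "sorted_wrt (\<lambda>x y. (x, y) \<in> r) ws"
    using linear_order_from_list[OF ws(1)] ws(2) by auto
  have "vertex_induced V E C"
    unfolding vertex_induced_def
  proof (intro exI[of _ r] conjI ballI)
    fix e assume "e \<in> E"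
    moreover have "sorted_wrt (\<lambda>x y. (x, y) \<in> r) (vs e)"
      using r(2) by (simp add: vs_def sorted_wrt_filter)
    ultimately show "\<exists>l. distinct l \<and> set l = e \<and> sorted_wrt (\<lambda>x y. (x, y) \<in> r) l \<and>
        C e = cycle_of_list l"
      using vs[of e] by (intro exI[of _ "vs e"]) (simp add: C_def)
  qed (rule r(1))
  moreover have "\<not> digraph_ready (cycling_digraph V E C) q c S"
    if "S \<noteq> {}" and S: "S \<subseteq> V - {q}" for S
  proof -
    have "\<exists>x\<in>set us. x \<in> S"
      using that us(2) by auto
    then obtain xs x zs where split: "us = xs @ x # zs" and "x \<in> S" and last: "\<forall>z\<in>set zs. z \<notin> S"
      by (rule split_list_last_propE)
    have "C e x \<notin> S" if e: "e \<in> E" "x \<in> e" "\<not> e \<subseteq> insert x (set xs)" for e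
    proof -
      let ?ys = "filter (\<lambda>x. x \<in> e) (zs @ [q])"
      have decomp: "vs e = filter (\<lambda>x. x \<in> e) xs @ x # ?ys"
        using e(2) by (simp add: vs_def ws_def split)
      obtain y where y: "y \<in> e" "y \<notin> insert x (set xs)"
        using e(3) by blast
      have "y \<in> set (vs e)"
        using y(1) vs(2)[OF e(1)] by simp
      then have "y \<in> set ?ys"
        using y unfolding decomp by simp
      then obtain z zs' where z: "?ys = z # zs'"
        by (meson list.set_cases)
      have "C e x = z"
        using vs(1)[OF e(1)] unfolding C_def decomp z by (rule cycle_of_list_successor)
      moreover have "z \<in> insert q (set zs)"
      proof -
        have "z \<in> set ?ys"
          unfolding z by simp
        then show ?thesis by (auto split: if_splits)
      qed
      ultimately show ?thesis
        using last S by auto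
    qed
    then have "card {e \<in> E. x \<in> e \<and> \<not> e \<subseteq> insert x (set xs)} \<le> card {e \<in> E. x \<in> e \<and> C e x \<notin> S}"
      using finE by (intro card_mono) auto
    then have "c x < card {e \<in> E. x \<in> e \<and> C e x \<notin> S}"
      using burn[OF split] by simp
    then show ?thesis
      using \<open>x \<in> S\<close> by (auto simp: digraph_ready_cycling_iff[OF assms(1) C S] not_le)
  qed
  ultimately show "\<exists>C. cycling E C \<and> vertex_induced V E C \<and>
      digraph_superstable (cycling_digraph V E C) q c"
    using C by (auto simp: digraph_superstable_def cycling_digraph_def)
qed

end
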